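(* Let $f_1,f_2:\mathbb{R}^d\to\mathbb{R}$ be in $\mathcal{C}^2$, $x_0\in\mathbb{R}^d$, $\bar\Delta>0$, and for $i\in\{1,2\}$ let $\{\widetilde f_{i,\Delta}\}_{(0,\bar\Delta]}$ be a class of models of $f_i$ parameterized by $\Delta\in(0,\bar\Delta]$. Assume $f_2(x)\ne0$ and $\widetilde f_{2,\Delta}(x)\ne0$ for all $\Delta\in(0,\bar\Delta]$ and $x\in B_\Delta(x_0)$, and put $F=f_1/f_2$, $\widetilde F_\Delta=\widetilde f_{1,\Delta}/\widetilde f_{2,\Delta}$. Suppose that for all $i\in\{1,2\}$ the class $\{\widetilde f_{i,\Delta}\}_{(0,\bar\Delta]}$ provides order-$N_i^f$ function accuracy of $f_i$ near $x_0$, order-$N_i^g$ gradient accuracy of $f_i$ near $x_0$, and order-$N_i^h$ Hessian accuracy of $f_i$ near $x_0$. If $N_2^f>0$, then $\{\widetilde F_\Delta\}_{(0,\bar\Delta]}$ provides order-$N_F^{fgh}$ Hessian accuracy for $F$ near $x_0$, where $N_F^{fgh}=\min\{N_1^f,N_2^f,N_1^g,N_2^g,N_1^h,N_2^h\}$.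
   Context: $\|\cdot\|$ is a norm (e.g. the Euclidean norm for vectors and the induced operator norm for matrices); $B_\Delta(x_0)$ is the closed ball of radius $\Delta$ centered at $x_0$. A class of models of $f:\mathbb{R}^d\to\mathbb{R}$ is a family of functions $\widetilde f_\Delta:\mathbb{R}^d\to\mathbb{R}$ indexed by $\Delta\in(0,\bar\Delta]$; when gradients or Hessians of models appear, the models are understood to be differentiable, respectively twice differentiable. For $N\ge0$, the class provides order-$N$ function (respectively gradient, Hessian) accuracy of $f$ near $x_0$ if there exists a scalar $\kappa\ge0$ (which may depend on $x_0$) such that for all $\Delta\in(0,\bar\Delta]$ and all $x\in B_\Delta(x_0)$ one has $|f(x)-\widetilde f_\Delta(x)|\le\kappa\Delta^N$ (respectively $\|\nabla f(x)-\nabla\widetilde f_\Delta(x)\|\le\kappa\Delta^N$, $\|\nabla^2f(x)-\nabla^2\widetilde f_\Delta(x)\|\le\kappa\Delta^N$).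
   Formalization: The claim can fail if f̃_{2,Δ} nears 0 as Δ varies away from 0. Proved instead: the accuracy for Δ in (0,r] for some 0<r≤Δ̄, and on all of (0,Δ̄] if for each ε>0, |f̃_{2,Δ}(x)| has a positive lower bound uniform over Δ in [ε,Δ̄], x in B_Δ(x_0). *)

theory Defs
  imports "HOL-Analysis.Analysis"
begin

definition is_norm :: "('v::real_vector \<Rightarrow> real) \<Rightarrow> bool" where
  "is_norm p \<longleftrightarrow>
     (\<forall>x. p x = 0 \<longleftrightarrow> x = 0) \<and>
     (\<forall>c x. p (c *\<^sub>R x) = \<bar>c\<bar> * p x) \<and>
     (\<forall>x y. p (x + y) \<le> p x + p y)"

definition norm_cball :: "('v::real_vector \<Rightarrow> real) \<Rightarrow> 'v \<Rightarrow> real \<Rightarrow> 'v set" where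
  "norm_cball p x0 r = {x. p (x - x0) \<le> r}"

definition gradient :: "(real^'d \<Rightarrow> real) \<Rightarrow> real^'d \<Rightarrow> real^'d" where
  "gradient f x = (THE D. GDERIV f x :> D)"

definition hessian :: "(real^'d \<Rightarrow> real) \<Rightarrow> real^'d \<Rightarrow> real^'d^'d" where
  "hessian f x = matrix (frechet_derivative (gradient f) (at x))"

definition twice_differentiable_at :: "(real^'d \<Rightarrow> real) \<Rightarrow> real^'d \<Rightarrow> bool" where
  "twice_differentiable_at f x \<longleftrightarrow>
     (\<forall>\<^sub>F y in nhds x. f differentiable (at y)) \<and> gradient f differentiable (at x)"

definition C2 :: "(real^'d \<Rightarrow> real) \<Rightarrow> bool" where
  "C2 f \<longleftrightarrow> (\<forall>x. twice_differentiable_at f x) \<and> continuous_on UNIV (hessian f)"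

text \<open>
  In the accuracy notions below, \<open>p\<close> is the norm on vectors, \<open>q\<close> the norm on matrices, \<open>R\<close> the
  largest radius, and \<open>m \<Delta>\<close> the model with parameter \<open>\<Delta>\<close>. Only \<open>\<Delta> > 0\<close> occurs, so \<open>powr\<close> is the
  ordinary power, with a real order \<open>N\<close>. As \<^const>\<open>gradient\<close> and \<^const>\<open>hessian\<close> return an
  unspecified value where the derivative does not exist, the last two notions also require it to
  exist.
\<close>

definition function_accuracy ::
  "(real^'d \<Rightarrow> real) \<Rightarrow> real \<Rightarrow> real \<Rightarrow> (real^'d \<Rightarrow> real) \<Rightarrow> (real \<Rightarrow> real^'d \<Rightarrow> real) \<Rightarrow> real^'d \<Rightarrow> bool"
where
  "function_accuracy p R N f m x0 \<longleftrightarrow>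
     (\<exists>\<kappa>\<ge>0. \<forall>\<Delta>\<in>{0<..R}. \<forall>x\<in>norm_cball p x0 \<Delta>. \<bar>f x - m \<Delta> x\<bar> \<le> \<kappa> * \<Delta> powr N)"

definition gradient_accuracy ::
  "(real^'d \<Rightarrow> real) \<Rightarrow> real \<Rightarrow> real \<Rightarrow> (real^'d \<Rightarrow> real) \<Rightarrow> (real \<Rightarrow> real^'d \<Rightarrow> real) \<Rightarrow> real^'d \<Rightarrow> bool"
where
  "gradient_accuracy p R N f m x0 \<longleftrightarrow>
     (\<exists>\<kappa>\<ge>0. \<forall>\<Delta>\<in>{0<..R}. \<forall>x\<in>norm_cball p x0 \<Delta>.
        f differentiable (at x) \<and> m \<Delta> differentiable (at x) \<and>
        p (gradient f x - gradient (m \<Delta>) x) \<le> \<kappa> * \<Delta> powr N)"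

definition hessian_accuracy ::
  "(real^'d \<Rightarrow> real) \<Rightarrow> (real^'d^'d \<Rightarrow> real) \<Rightarrow> real \<Rightarrow> real \<Rightarrow>
   (real^'d \<Rightarrow> real) \<Rightarrow> (real \<Rightarrow> real^'d \<Rightarrow> real) \<Rightarrow> real^'d \<Rightarrow> bool"
where
  "hessian_accuracy p q R N f m x0 \<longleftrightarrow>
     (\<exists>\<kappa>\<ge>0. \<forall>\<Delta>\<in>{0<..R}. \<forall>x\<in>norm_cball p x0 \<Delta>.
        twice_differentiable_at f x \<and> twice_differentiable_at (m \<Delta>) x \<and>
        q (hessian f x - hessian (m \<Delta>) x) \<le> \<kappa> * \<Delta> powr N)"

end

theory Submission
  imports Defs
begin

text \<open>
  By the product and reciprocal rules, the Hessian of a quotient is a polynomial in the values,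
  gradients and Hessians of numerator and denominator and in the reciprocal of the denominator.
  On the compact ball of radius \<open>R\<close> all these quantities are bounded for \<open>f\<^sub>1\<close> and \<open>f\<^sub>2\<close>, hence also
  for the models, and \<open>\<bar>f\<^sub>2\<bar>\<close> is bounded below. Since the order \<open>N\<^sub>2\<^sup>f\<close> is positive, the
  denominators of the models are bounded away from zero for all small radii. Errors of bounded
  quantities propagate through bounded bilinear operations, and through reciprocals of quantities
  that are bounded away from zero, without loss of order.
\<close>

section \<open>Equivalence of norms\<close>

lemma is_norm_zero: "is_norm p \<Longrightarrow> p 0 = 0"
  and is_norm_eq_0: "is_norm p \<Longrightarrow> p x = 0 \<longleftrightarrow> x = 0"
  and is_norm_scaleR: "is_norm p \<Longrightarrow> p (c *\<^sub>R x) = \<bar>c\<bar> * p x"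
  and is_norm_triangle: "is_norm p \<Longrightarrow> p (x + y) \<le> p x + p y"
  by (auto simp: is_norm_def)

lemma is_norm_minus: "is_norm p \<Longrightarrow> p (- x) = p x"
  using is_norm_scaleR[of p "-1" x] by simp

lemma is_norm_nonneg:
  assumes "is_norm p"
  shows "0 \<le> p x"
  using is_norm_triangle[OF assms, of x "- x"] is_norm_minus[OF assms, of x]
    is_norm_zero[OF assms] by simp

lemma is_norm_sum:
  assumes "is_norm p" "finite A"
  shows "p (\<Sum>i\<in>A. g i) \<le> (\<Sum>i\<in>A. p (g i))"
  using assms(2)
proof (induction A rule: finite_induct)
  case empty
  then show ?case by (simp add: is_norm_zero[OF assms(1)])
next
  case (insert i A)
  then show ?case using is_norm_triangle[OF assms(1), of "g i" "\<Sum>i\<in>A. g i"] by simp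
qed

text \<open>Expanding \<open>x\<close> in the standard basis and applying the triangle inequality
  bounds \<open>p x\<close> by the coordinates, each of which is at most
  \<open>norm x\<close>.\<close>

lemma is_norm_le_norm:
  fixes p :: "'a::euclidean_space \<Rightarrow> real"
  assumes "is_norm p"
  obtains C where "C > 0" "\<And>x. p x \<le> C * norm x"
proof
  \<comment> \<open>The summand 1 makes \<open>C\<close> positive without having to exhibit a basis
    vector with \<open>p b > 0\<close>.\<close>
  define C where "C = (\<Sum>b\<in>Basis. p b) + 1"
  have s: "(\<Sum>b\<in>Basis. p b) \<ge> 0" by (intro sum_nonneg is_norm_nonneg assms)
  then show "C > 0" by (simp add: C_def)
  fix x :: 'a
  have "p x = p (\<Sum>b\<in>Basis. (x \<bullet> b) *\<^sub>R b)" by (simp add: euclidean_representation)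
  also have "\<dots> \<le> (\<Sum>b\<in>Basis. \<bar>x \<bullet> b\<bar> * p b)"
    using is_norm_sum[OF assms, of Basis "\<lambda>b. (x \<bullet> b) *\<^sub>R b"] by (simp add: is_norm_scaleR[OF assms])
  also have "\<dots> \<le> (\<Sum>b\<in>Basis. norm x * p b)"
    by (intro sum_mono mult_right_mono is_norm_nonneg assms Basis_le_norm)
  also have "\<dots> \<le> C * norm x" by (simp add: C_def sum_distrib_left[symmetric] algebra_simps)
  finally show "p x \<le> C * norm x" .
qed

text \<open>The reverse triangle inequality, combined with the upper bound by the Euclidean norm,
  makes \<open>p\<close> Lipschitz.\<close>

lemma continuous_on_is_norm:
  fixes p :: "'a::euclidean_space \<Rightarrow> real"
  assumes "is_norm p"
  shows "continuous_on S p"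
proof -
  obtain C where C: "C > 0" "\<And>x. p x \<le> C * norm x" using is_norm_le_norm[OF assms] by metis
  have le: "p x - p y \<le> C * norm (x - y)" for x y
    using is_norm_triangle[OF assms, of "x - y" y] C(2)[of "x - y"] by simp
  have "C-lipschitz_on S p"
  proof (rule lipschitz_onI)
    fix x y
    show "dist (p x) (p y) \<le> C * dist x y"
      using le[of x y] le[of y x] by (simp add: dist_norm norm_minus_commute abs_le_iff)
  qed (use C(1) in simp)
  then show ?thesis by (rule lipschitz_on_continuous_on)
qed

text \<open>The continuous function \<open>p\<close> attains its minimum on the compact Euclidean
  unit sphere. That minimum is positive by definiteness, and homogeneity carries the bound to all
  vectors.\<close>

lemma norm_le_is_norm:
  fixes p :: "'a::euclidean_space \<Rightarrow> real"
  assumes "is_norm p"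
  obtains C where "C > 0" "\<And>x. norm x \<le> C * p x"
proof -
  have "compact (sphere (0::'a) 1)" "sphere (0::'a) 1 \<noteq> {}" by auto
  then obtain u where u: "u \<in> sphere 0 1" "\<And>x. x \<in> sphere 0 1 \<Longrightarrow> p u \<le> p x"
    using continuous_attains_inf[OF _ _ continuous_on_is_norm[OF assms]] by metis
  have "p u \<noteq> 0" using u(1) is_norm_eq_0[OF assms, of u] by auto
  then have pos: "p u > 0" using is_norm_nonneg[OF assms, of u] by simp
  have "norm x \<le> inverse (p u) * p x" for x
  proof (cases "x = 0")
    case False
    then have "p u \<le> p (inverse (norm x) *\<^sub>R x)" by (intro u(2)) simp
    then have "p u \<le> inverse (norm x) * p x" by (simp add: is_norm_scaleR[OF assms])
    then show ?thesis using False pos by (simp add: field_simps)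
  qed (simp add: is_norm_zero[OF assms])
  then show thesis using that[of "inverse (p u)"] pos by simp
qed

text \<open>Boundedness comes from \<open>p\<close> dominating the Euclidean norm, closedness from
  the continuity of \<open>p\<close>. Continuous functions therefore have bounds and attained minima
  on the ball of radius \<open>R\<close>.\<close>

lemma compact_norm_cball:
  fixes p :: "'a::euclidean_space \<Rightarrow> real"
  assumes "is_norm p"
  shows "compact (norm_cball p x0 r)"
  unfolding compact_eq_bounded_closed
proof
  obtain C where C: "C > 0" "\<And>x. norm x \<le> C * p x" using norm_le_is_norm[OF assms] by metis
  have "norm_cball p x0 r \<subseteq> cball x0 (C * r)"
  proof
    fix x assume "x \<in> norm_cball p x0 r"
    then have "C * p (x - x0) \<le> C * r" using C(1) by (simp add: norm_cball_def)
    then show "x \<in> cball x0 (C * r)"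
      using C(2)[of "x - x0"] by (simp add: dist_norm norm_minus_commute)
  qed
  then show "bounded (norm_cball p x0 r)" using bounded_subset bounded_cball by blast
  show "closed (norm_cball p x0 r)"
    unfolding norm_cball_def
    by (intro closed_Collect_le continuous_on_const
        continuous_on_compose2[OF continuous_on_is_norm[OF assms, of UNIV]])
      (auto intro!: continuous_intros)
qed

section \<open>Gradients and Hessians of products and reciprocals\<close>

text \<open>The rank-one matrix \<open>a b^T\<close>. It represents the linear map sending
  \<open>h\<close> to \<open>(h \<bullet> b) *\<^sub>R a\<close>, which arises when the scalar
  factor of a vector field is differentiated.\<close>

definition outer :: "real^'d \<Rightarrow> real^'d \<Rightarrow> real^'d^'d" where
  "outer a b = (\<chi> i j. a $ i * b $ j)"

lemma outer_matrix_vector_mult: "outer a b *v h = (h \<bullet> b) *\<^sub>R a"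
  by (simp add: outer_def vec_eq_iff matrix_vector_mult_def inner_vec_def sum_distrib_left
      mult_ac)

lemma bounded_bilinear_outer: "bounded_bilinear outer"
  unfolding bilinear_conv_bounded_bilinear[symmetric] bilinear_def
  by (auto intro!: linearI simp: outer_def vec_eq_iff algebra_simps)

lemma GDERIV_imp_gradient_eq:
  assumes "GDERIV f x :> D"
  shows "gradient f x = D"
  unfolding gradient_def
proof (rule the_equality)
  fix D' assume "GDERIV f x :> D'"
  then have "(\<lambda>h. h \<bullet> D') = (\<lambda>h. h \<bullet> D)"
    using assms unfolding gderiv_def by (rule has_derivative_unique)
  then show "D' = D" by (metis inner_commute vector_eq_rdot)
qed (fact assms)

text \<open>Riesz representation: the adjoint of the derivative, applied to the scalar 1, is the
  vector that represents it.\<close>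

lemma differentiable_imp_GDERIV:
  fixes f :: "real^'d \<Rightarrow> real"
  assumes "f differentiable (at x)"
  shows "GDERIV f x :> gradient f x"
proof -
  obtain D where D: "(f has_derivative D) (at x)" using assms by (auto simp: differentiable_def)
  define v where "v = adjoint D 1"
  have "D h = h \<bullet> v" for h
    using adjoint_works[OF has_derivative_linear[OF D], of h 1] by (simp add: v_def)
  then have "D = (\<lambda>h. h \<bullet> v)" by auto
  then have "GDERIV f x :> v" using D by (simp add: gderiv_def)
  then show ?thesis using GDERIV_imp_gradient_eq by metis
qed

lemma GDERIV_imp_has_derivative: "GDERIV f x :> D \<Longrightarrow> (f has_derivative (\<lambda>h. h \<bullet> D)) (at x)"
  by (simp add: gderiv_def)

text \<open>A gradient formula valid near \<open>x\<close> can be differentiated in place of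
  \<open>gradient f\<close>. Validity at \<open>x\<close> alone would not suffice, since the
  derivative depends on nearby values.\<close>

lemma has_derivative_imp_hessian:
  assumes "\<forall>\<^sub>F y in nhds x. GDERIV f y :> g y"
    and "(g has_derivative (\<lambda>h. H *v h)) (at x)"
  shows "twice_differentiable_at f x" "gradient f x = g x" "hessian f x = H"
proof -
  have ev: "\<forall>\<^sub>F y in nhds x. gradient f y = g y"
    using assms(1) by eventually_elim (rule GDERIV_imp_gradient_eq)
  then show eq: "gradient f x = g x" by (rule eventually_nhds_x_imp_x)
  \<comment> \<open>Transferring a derivative takes agreement on a punctured neighbourhood together
    with agreement at \<open>x\<close> itself, which is \<open>eq\<close>.\<close>
  have "\<forall>\<^sub>F y in at x. g y = gradient f y"
    using ev unfolding eventually_at_filter by eventually_elim simp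
  then have D: "(gradient f has_derivative (\<lambda>h. H *v h)) (at x)"
    using has_derivative_transform_eventually[OF assms(2)] eq by simp
  have "\<forall>\<^sub>F y in nhds x. f differentiable (at y)"
    using assms(1) by eventually_elim (auto simp: gderiv_def differentiable_def)
  then show "twice_differentiable_at f x"
    using D by (auto simp: twice_differentiable_at_def differentiable_def)
  show "hessian f x = H"
    using frechet_derivative_at[OF D] unfolding hessian_def by (metis matrix_of_matrix_vector_mul)
qed

lemma twice_differentiable_atD:
  assumes "twice_differentiable_at f x"
  shows "\<forall>\<^sub>F y in nhds x. GDERIV f y :> gradient f y"
    and "(gradient f has_derivative (\<lambda>h. hessian f x *v h)) (at x)"
    and "isCont f x" "isCont (gradient f) x"
proof -
  have ev: "\<forall>\<^sub>F y in nhds x. f differentiable (at y)" and d: "gradient f differentiable (at x)"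
    using assms by (auto simp: twice_differentiable_at_def)
  show "\<forall>\<^sub>F y in nhds x. GDERIV f y :> gradient f y"
    using ev by eventually_elim (rule differentiable_imp_GDERIV)
  have D: "(gradient f has_derivative frechet_derivative (gradient f) (at x)) (at x)"
    using d by (simp add: frechet_derivative_works)
  then show "(gradient f has_derivative (\<lambda>h. hessian f x *v h)) (at x)"
    unfolding hessian_def using matrix_vector_mul(2)[OF has_derivative_linear[OF D]] by simp
  show "isCont f x"
    using eventually_nhds_x_imp_x[OF ev] by (rule differentiable_imp_continuous_within)
  show "isCont (gradient f) x" using d by (rule differentiable_imp_continuous_within)
qed

text \<open>The gradient of the product is \<open>f\<close> times the gradient of \<open>g\<close>
  plus the symmetric term. Differentiating each scalar factor yields one of the two outer products,
  differentiating each gradient yields a Hessian.\<close>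

lemma twice_differentiable_at_mult:
  assumes f: "twice_differentiable_at f x" and g: "twice_differentiable_at g x"
  shows "twice_differentiable_at (\<lambda>y. f y * g y) x"
    and "hessian (\<lambda>y. f y * g y) x =
      f x *\<^sub>R hessian g x + g x *\<^sub>R hessian f x
      + (outer (gradient g x) (gradient f x) + outer (gradient f x) (gradient g x))"
      (is "_ = ?H")
proof -
  note df = twice_differentiable_atD[OF f] and dg = twice_differentiable_atD[OF g]
  have ev: "\<forall>\<^sub>F y in nhds x.
      GDERIV (\<lambda>y. f y * g y) y :> f y *\<^sub>R gradient g y + g y *\<^sub>R gradient f y"
    using df(1) dg(1) by eventually_elim (rule GDERIV_mult)
  have D: "((\<lambda>y. f y *\<^sub>R gradient g y + g y *\<^sub>R gradient f y) has_derivative (\<lambda>h. ?H *v h)) (at x)"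
    by (rule has_derivative_eq_rhs[OF has_derivative_add[OF
          has_derivative_scaleR[OF GDERIV_imp_has_derivative dg(2)]
          has_derivative_scaleR[OF GDERIV_imp_has_derivative df(2)]]])
      (auto intro!: eventually_nhds_x_imp_x[OF df(1)] eventually_nhds_x_imp_x[OF dg(1)]
        simp: outer_matrix_vector_mult matrix_vector_mult_add_rdistrib scaleR_matrix_vector_assoc)
  show "twice_differentiable_at (\<lambda>y. f y * g y) x" "hessian (\<lambda>y. f y * g y) x = ?H"
    using has_derivative_imp_hessian[OF ev D] by auto
qed

text \<open>The gradient of the reciprocal is the gradient of \<open>f\<close> times minus the
  squared reciprocal. Differentiating this scalar gives the cubic factor and a further gradient,
  hence the outer product.\<close>

lemma twice_differentiable_at_inverse:
  assumes f: "twice_differentiable_at f x" and nz: "f x \<noteq> 0"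
  shows "twice_differentiable_at (\<lambda>y. inverse (f y)) x"
    and "gradient (\<lambda>y. inverse (f y)) x = - (inverse (f x))\<^sup>2 *\<^sub>R gradient f x"
    and "hessian (\<lambda>y. inverse (f y)) x =
      - (inverse (f x))\<^sup>2 *\<^sub>R hessian f x
      + (2 * inverse (f x) ^ 3) *\<^sub>R outer (gradient f x) (gradient f x)"
      (is "_ = ?H")
proof -
  note df = twice_differentiable_atD[OF f]
  \<comment> \<open>By continuity \<open>f\<close> stays nonzero near \<open>x\<close>, so the
    gradient formula holds on a whole neighbourhood.\<close>
  have "\<forall>\<^sub>F y in nhds x. f y \<noteq> 0"
    using df(3) nz by (intro tendsto_imp_eventually_ne) (simp_all add: isCont_def tendsto_at_iff_tendsto_nhds)
  then have ev: "\<forall>\<^sub>F y in nhds x.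
      GDERIV (\<lambda>y. inverse (f y)) y :> - (inverse (f y))\<^sup>2 *\<^sub>R gradient f y"
    using df(1) by eventually_elim (rule GDERIV_inverse)
  have fx: "(f has_derivative (\<lambda>h. h \<bullet> gradient f x)) (at x)"
    using eventually_nhds_x_imp_x[OF df(1)] by (rule GDERIV_imp_has_derivative)
  have "((\<lambda>y. - (inverse (f y))\<^sup>2) has_derivative
      (\<lambda>h. 2 * inverse (f x) ^ 3 * (h \<bullet> gradient f x))) (at x)"
    using nz by (auto intro!: derivative_eq_intros fx simp: power2_eq_square power3_eq_cube)
  then have D: "((\<lambda>y. - (inverse (f y))\<^sup>2 *\<^sub>R gradient f y) has_derivative (\<lambda>h. ?H *v h)) (at x)"
    by (rule has_derivative_eq_rhs[OF has_derivative_scaleR[OF _ df(2)]])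
      (simp add: outer_matrix_vector_mult matrix_vector_mult_add_rdistrib
        scaleR_matrix_vector_assoc[symmetric] flip: scaleR_minus_left)
  show "twice_differentiable_at (\<lambda>y. inverse (f y)) x"
    "gradient (\<lambda>y. inverse (f y)) x = - (inverse (f x))\<^sup>2 *\<^sub>R gradient f x"
    "hessian (\<lambda>y. inverse (f y)) x = ?H"
    using has_derivative_imp_hessian[OF ev D] by auto
qed

section \<open>Propagation of errors\<close>

text \<open>Error of order \<open>e\<close> with constants uniform over the index set. Boundedness
  of both families is part of the notion because it makes the notion stable under products.\<close>

definition close_on ::
  "'i set \<Rightarrow> ('i \<Rightarrow> real) \<Rightarrow> ('i \<Rightarrow> 'a::real_normed_vector) \<Rightarrow> ('i \<Rightarrow> 'a) \<Rightarrow> bool"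
where
  "close_on S e A B \<longleftrightarrow> (\<exists>C\<ge>0. \<exists>\<kappa>\<ge>0. \<forall>i\<in>S.
     norm (A i) \<le> C \<and> norm (B i) \<le> C \<and> norm (A i - B i) \<le> \<kappa> * e i)"

lemma close_onI:
  assumes "C \<ge> 0" "\<kappa> \<ge> 0"
    and "\<And>i. i \<in> S \<Longrightarrow> norm (A i) \<le> C" "\<And>i. i \<in> S \<Longrightarrow> norm (B i) \<le> C"
    and "\<And>i. i \<in> S \<Longrightarrow> norm (A i - B i) \<le> \<kappa> * e i"
  shows "close_on S e A B"
  using assms unfolding close_on_def by blast

lemma close_onE:
  assumes "close_on S e A B"
  obtains C \<kappa> where "C \<ge> 0" "\<kappa> \<ge> 0"
    "\<And>i. i \<in> S \<Longrightarrow> norm (A i) \<le> C" "\<And>i. i \<in> S \<Longrightarrow> norm (B i) \<le> C"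
    "\<And>i. i \<in> S \<Longrightarrow> norm (A i - B i) \<le> \<kappa> * e i"
  using assms unfolding close_on_def by blast

lemma close_on_subset:
  assumes "close_on S e A B" "T \<subseteq> S"
  shows "close_on T e A B"
  using assms unfolding close_on_def by (meson subsetD)

lemma close_on_cong:
  assumes "\<And>i. i \<in> S \<Longrightarrow> A i = A' i" "\<And>i. i \<in> S \<Longrightarrow> B i = B' i"
  shows "close_on S e A B = close_on S e A' B'"
  using assms unfolding close_on_def by simp

lemma close_on_const: "close_on S e (\<lambda>_. c) (\<lambda>_. c)"
  by (rule close_onI[of "norm c" 0]) auto

lemma close_on_add:
  assumes "close_on S e A A'" "close_on S e B B'"
  shows "close_on S e (\<lambda>i. A i + B i) (\<lambda>i. A' i + B' i)"
proof -
  obtain C \<kappa> where A: "C \<ge> 0" "\<kappa> \<ge> 0" "\<And>i. i \<in> S \<Longrightarrow> norm (A i) \<le> C"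
    "\<And>i. i \<in> S \<Longrightarrow> norm (A' i) \<le> C" "\<And>i. i \<in> S \<Longrightarrow> norm (A i - A' i) \<le> \<kappa> * e i"
    using close_onE[OF assms(1)] by metis
  obtain D \<mu> where B: "D \<ge> 0" "\<mu> \<ge> 0" "\<And>i. i \<in> S \<Longrightarrow> norm (B i) \<le> D"
    "\<And>i. i \<in> S \<Longrightarrow> norm (B' i) \<le> D" "\<And>i. i \<in> S \<Longrightarrow> norm (B i - B' i) \<le> \<mu> * e i"
    using close_onE[OF assms(2)] by metis
  show ?thesis
    by (rule close_onI[of "C + D" "\<kappa> + \<mu>"])
      (use A B in \<open>auto intro!: norm_triangle_mono norm_diff_triangle_le
        simp: add_diff_add distrib_right\<close>)
qed

text \<open>The difference of two products splits into two terms, each with one error and one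
  bounded factor, so the order of the error is kept.\<close>

lemma close_on_bilinear:
  assumes "bounded_bilinear prd" "close_on S e A A'" "close_on S e B B'"
  shows "close_on S e (\<lambda>i. prd (A i) (B i)) (\<lambda>i. prd (A' i) (B' i))"
proof -
  interpret bounded_bilinear prd by fact
  obtain K where K: "K \<ge> 0" "\<And>a b. norm (prd a b) \<le> norm a * norm b * K"
    using nonneg_bounded by blast
  obtain C \<kappa> where A: "C \<ge> 0" "\<kappa> \<ge> 0" "\<And>i. i \<in> S \<Longrightarrow> norm (A i) \<le> C"
    "\<And>i. i \<in> S \<Longrightarrow> norm (A' i) \<le> C" "\<And>i. i \<in> S \<Longrightarrow> norm (A i - A' i) \<le> \<kappa> * e i"
    using close_onE[OF assms(2)] by metis
  obtain D \<mu> where B: "D \<ge> 0" "\<mu> \<ge> 0" "\<And>i. i \<in> S \<Longrightarrow> norm (B i) \<le> D"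
    "\<And>i. i \<in> S \<Longrightarrow> norm (B' i) \<le> D" "\<And>i. i \<in> S \<Longrightarrow> norm (B i - B' i) \<le> \<mu> * e i"
    using close_onE[OF assms(3)] by metis
  have bound: "norm (prd a b) \<le> s * t * K" if "norm a \<le> s" "norm b \<le> t" for a b s t
  proof -
    \<comment> \<open>No sign of \<open>e\<close> is assumed. The bound \<open>s\<close> may be
      \<open>\<kappa> * e i\<close>, and it is nonnegative because it bounds a norm.\<close>
    have "0 \<le> s" using that(1) norm_ge_zero order_trans by blast
    then have "norm a * norm b * K \<le> s * t * K"
      using that K(1) by (intro mult_right_mono mult_mono) auto
    then show ?thesis using K(2)[of a b] by linarith
  qed
  show ?thesis
  proof (rule close_onI[of "C * D * K" "\<kappa> * D * K + C * \<mu> * K"])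
    fix i assume i: "i \<in> S"
    have "prd (A i) (B i) - prd (A' i) (B' i) = prd (A i - A' i) (B i) + prd (A' i) (B i - B' i)"
      by (simp add: diff_left diff_right)
    also have "norm \<dots> \<le> (\<kappa> * e i) * D * K + C * (\<mu> * e i) * K"
      using A B i by (intro norm_triangle_mono bound) auto
    finally show "norm (prd (A i) (B i) - prd (A' i) (B' i)) \<le> (\<kappa> * D * K + C * \<mu> * K) * e i"
      by (simp add: algebra_simps)
  qed (use A B K bound in auto)
qed

lemmas close_on_scaleR = close_on_bilinear[OF bounded_bilinear_scaleR]
lemmas close_on_mult = close_on_bilinear[OF bounded_bilinear_mult]
lemmas close_on_outer = close_on_bilinear[OF bounded_bilinear_outer]

lemma close_on_minus: "close_on S e A B \<Longrightarrow> close_on S e (\<lambda>i. - A i) (\<lambda>i. - B i)"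
  using close_on_scaleR[OF close_on_const[of S e "-1"], of A B] by simp

lemma close_on_power:
  fixes A B :: "'i \<Rightarrow> 'a::real_normed_algebra_1"
  assumes "close_on S e A B"
  shows "close_on S e (\<lambda>i. A i ^ n) (\<lambda>i. B i ^ n)"
  by (induction n) (use assms in \<open>auto intro: close_on_const close_on_mult\<close>)

text \<open>The difference of two reciprocals is the difference of the arguments, up to sign, times
  both reciprocals, and these are at most \<open>inverse b\<close>.\<close>

lemma close_on_inverse:
  fixes A B :: "'i \<Rightarrow> 'a::real_normed_field"
  assumes "close_on S e A B" "b > 0"
    and b: "\<And>i. i \<in> S \<Longrightarrow> b \<le> norm (A i)" "\<And>i. i \<in> S \<Longrightarrow> b \<le> norm (B i)"
  shows "close_on S e (\<lambda>i. inverse (A i)) (\<lambda>i. inverse (B i))"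
proof -
  obtain C \<kappa> where A: "C \<ge> 0" "\<kappa> \<ge> 0" "\<And>i. i \<in> S \<Longrightarrow> norm (A i) \<le> C"
    "\<And>i. i \<in> S \<Longrightarrow> norm (B i) \<le> C" "\<And>i. i \<in> S \<Longrightarrow> norm (A i - B i) \<le> \<kappa> * e i"
    using close_onE[OF assms(1)] by metis
  have inv: "norm (inverse a) \<le> inverse b" if "b \<le> norm a" for a :: 'a
    using that \<open>b > 0\<close> by (simp add: norm_inverse le_imp_inverse_le)
  show ?thesis
  proof (rule close_onI[of "inverse b" "inverse b * \<kappa> * inverse b"])
    fix i assume i: "i \<in> S"
    have "A i \<noteq> 0" "B i \<noteq> 0" using b[OF i] \<open>b > 0\<close> by auto
    then have "norm (inverse (A i) - inverse (B i))
        = norm (inverse (A i)) * norm (A i - B i) * norm (inverse (B i))"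
      by (simp add: inverse_diff_inverse norm_mult)
    also have "\<dots> \<le> inverse b * (\<kappa> * e i) * inverse b"
      using inv[OF b(1)[OF i]] inv[OF b(2)[OF i]] A(5)[OF i] \<open>b > 0\<close>
        order_trans[OF norm_ge_zero A(5)[OF i]]
      by (intro mult_mono) auto
    finally show "norm (inverse (A i) - inverse (B i)) \<le> inverse b * \<kappa> * inverse b * e i"
      by (simp add: mult_ac)
  qed (use \<open>b > 0\<close> A inv b in auto)
qed

text \<open>Only \<open>A\<close> has to be bounded beforehand: \<open>B\<close> differs from it by
  at most \<open>\<kappa> * e i\<close>, and the scale \<open>e\<close> is bounded above.\<close>

lemma close_onI_bounded:
  assumes "\<kappa> \<ge> 0" "\<And>i. i \<in> S \<Longrightarrow> norm (A i) \<le> C"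
    and "\<And>i. i \<in> S \<Longrightarrow> norm (A i - B i) \<le> \<kappa> * e i" "\<And>i. i \<in> S \<Longrightarrow> e i \<le> E"
  shows "close_on S e A B"
\<comment> \<open>The signs of \<open>C\<close> and \<open>E\<close> are unknown, hence the absolute
  values.\<close>
proof (rule close_onI[of "\<bar>C\<bar> + \<kappa> * \<bar>E\<bar>" \<kappa>])
  fix i assume i: "i \<in> S"
  have E: "\<kappa> * e i \<le> \<kappa> * \<bar>E\<bar>"
    using assms(4)[OF i] \<open>\<kappa> \<ge> 0\<close> by (intro mult_left_mono) auto
  show "norm (A i) \<le> \<bar>C\<bar> + \<kappa> * \<bar>E\<bar>"
    using assms(2)[OF i] \<open>\<kappa> \<ge> 0\<close> by (smt (verit) abs_ge_self abs_ge_zero mult_nonneg_nonneg)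
  show "norm (B i) \<le> \<bar>C\<bar> + \<kappa> * \<bar>E\<bar>"
    using assms(2,3)[OF i] E norm_triangle_ineq4[of "A i" "A i - B i"] by simp
qed (use assms in auto)

text \<open>Lowers an accuracy order from \<open>N\<close> to \<open>M\<close>: the surplus power of
  \<open>x\<close> is absorbed into a constant, as \<open>x\<close> is at most
  \<open>R\<close>.\<close>

lemma powr_le_powr_times:
  fixes x R N M :: real
  assumes "0 < x" "x \<le> R" "M \<le> N"
  shows "x powr N \<le> R powr (N - M) * x powr M"
proof -
  have "x powr N = x powr (N - M) * x powr M" by (simp flip: powr_add)
  also have "\<dots> \<le> R powr (N - M) * x powr M"
    using assms by (intro mult_right_mono powr_mono2) auto
  finally show ?thesis .
qed

section \<open>Models of a function\<close>

text \<open>Radius and point form a single index, so that the constants of \<open>close_on\<close>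
  are uniform in both.\<close>

definition trust_pairs :: "('v::real_vector \<Rightarrow> real) \<Rightarrow> 'v \<Rightarrow> real \<Rightarrow> (real \<times> 'v) set" where
  "trust_pairs p x0 R = (SIGMA \<Delta>:{0<..R}. norm_cball p x0 \<Delta>)"

text \<open>Serves values, gradients and Hessians alike, with \<open>s\<close> the norm in which the
  error is measured. Compactness bounds \<open>g\<close>, and \<open>0 \<le> N\<close> bounds the
  scale by \<open>R powr N\<close>, so the models are bounded as well.\<close>

lemma close_on_model:
  fixes g :: "real^'d \<Rightarrow> 'a::euclidean_space" and m :: "real \<Rightarrow> real^'d \<Rightarrow> 'a"
  assumes p: "is_norm p" and s: "is_norm s" and "0 \<le> N" "N \<le> M"
    and cont: "continuous_on UNIV g" and "\<kappa> \<ge> 0"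
    and acc: "\<And>\<Delta> x. 0 < \<Delta> \<Longrightarrow> \<Delta> \<le> R \<Longrightarrow> x \<in> norm_cball p x0 \<Delta> \<Longrightarrow>
      s (g x - m \<Delta> x) \<le> \<kappa> * \<Delta> powr M"
  shows "close_on (trust_pairs p x0 R) (\<lambda>i. fst i powr N) (\<lambda>i. g (snd i)) (\<lambda>i. m (fst i) (snd i))"
proof -
  obtain K where K: "K > 0" "\<And>v. norm v \<le> K * s v" using norm_le_is_norm[OF s] by metis
  have "compact (g ` norm_cball p x0 R)"
    by (intro compact_continuous_image compact_norm_cball p continuous_on_subset[OF cont]) auto
  then obtain C where C: "\<And>x. x \<in> norm_cball p x0 R \<Longrightarrow> norm (g x) \<le> C"
    using compact_imp_bounded bounded_iff by (metis imageI)
  show ?thesis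
  \<comment> \<open>\<open>K\<close> passes from \<open>s\<close> to the Euclidean norm, and
    \<open>R powr (M - N)\<close> pays for lowering the order from \<open>M\<close> to
    \<open>N\<close>.\<close>
  proof (rule close_onI_bounded[of "K * \<kappa> * R powr (M - N)" _ _ C _ _ "R powr N"])
    fix i assume "i \<in> trust_pairs p x0 R"
    then obtain \<Delta> x where i: "i = (\<Delta>, x)" "0 < \<Delta>" "\<Delta> \<le> R" "x \<in> norm_cball p x0 \<Delta>"
      by (auto simp: trust_pairs_def)
    then show "norm (g (snd i)) \<le> C" using C by (auto simp: norm_cball_def)
    show "fst i powr N \<le> R powr N"
      using i \<open>0 \<le> N\<close> by (auto intro: powr_mono2)
    have "norm (g x - m \<Delta> x) \<le> K * s (g x - m \<Delta> x)" by (rule K)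
    also have "\<dots> \<le> K * (\<kappa> * (R powr (M - N) * \<Delta> powr N))"
      using K(1) \<open>\<kappa> \<ge> 0\<close> acc[OF i(2-4)] powr_le_powr_times[OF i(2,3) \<open>N \<le> M\<close>]
      by (intro mult_left_mono order_trans[OF acc[OF i(2-4)]]) auto
    finally show "norm (g (snd i) - m (fst i) (snd i))
        \<le> K * \<kappa> * R powr (M - N) * fst i powr N"
      using i by (simp add: mult_ac)
  qed (use K \<open>\<kappa> \<ge> 0\<close> in auto)
qed

section \<open>Translation between accuracy orders and closeness\<close>

lemma C2D:
  assumes "C2 f"
  shows "twice_differentiable_at f x" "continuous_on UNIV f" "continuous_on UNIV (gradient f)"
    "continuous_on UNIV (hessian f)"
  using assms by (auto simp: C2_def continuous_on_eq_continuous_at dest: twice_differentiable_atD)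

lemma is_norm_abs: "is_norm (abs :: real \<Rightarrow> real)"
  by (auto simp: is_norm_def abs_mult abs_triangle_ineq)

lemma close_on_function_accuracy:
  assumes "is_norm p" "C2 f" "0 \<le> N" "N \<le> M" "function_accuracy p R M f m x0"
  shows "close_on (trust_pairs p x0 R) (\<lambda>i. fst i powr N) (\<lambda>i. f (snd i)) (\<lambda>i. m (fst i) (snd i))"
proof -
  obtain \<kappa> where "\<kappa> \<ge> 0" "\<forall>\<Delta>\<in>{0<..R}. \<forall>x\<in>norm_cball p x0 \<Delta>. \<bar>f x - m \<Delta> x\<bar> \<le> \<kappa> * \<Delta> powr M"
    using assms(5) unfolding function_accuracy_def by blast
  then show ?thesis
    by (intro close_on_model[OF assms(1) is_norm_abs assms(3,4) C2D(2)[OF assms(2)]]) auto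
qed

lemma close_on_gradient_accuracy:
  assumes "is_norm p" "C2 f" "0 \<le> N" "N \<le> M" "gradient_accuracy p R M f m x0"
  shows "close_on (trust_pairs p x0 R) (\<lambda>i. fst i powr N)
    (\<lambda>i. gradient f (snd i)) (\<lambda>i. gradient (m (fst i)) (snd i))"
proof -
  obtain \<kappa> where "\<kappa> \<ge> 0" "\<forall>\<Delta>\<in>{0<..R}. \<forall>x\<in>norm_cball p x0 \<Delta>.
      p (gradient f x - gradient (m \<Delta>) x) \<le> \<kappa> * \<Delta> powr M"
    using assms(5) unfolding gradient_accuracy_def by blast
  then show ?thesis
    by (intro close_on_model[OF assms(1,1,3,4) C2D(3)[OF assms(2)]]) auto
qed

lemma close_on_hessian_accuracy:
  assumes "is_norm p" "is_norm q" "C2 f" "0 \<le> N" "N \<le> M" "hessian_accuracy p q R M f m x0"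
  shows "close_on (trust_pairs p x0 R) (\<lambda>i. fst i powr N)
    (\<lambda>i. hessian f (snd i)) (\<lambda>i. hessian (m (fst i)) (snd i))"
proof -
  obtain \<kappa> where "\<kappa> \<ge> 0" "\<forall>\<Delta>\<in>{0<..R}. \<forall>x\<in>norm_cball p x0 \<Delta>.
      q (hessian f x - hessian (m \<Delta>) x) \<le> \<kappa> * \<Delta> powr M"
    using assms(6) unfolding hessian_accuracy_def by blast
  then show ?thesis
    by (intro close_on_model[OF assms(1,2,4,5) C2D(4)[OF assms(3)]]) auto
qed

text \<open>The way back from Euclidean closeness, using the other half of the equivalence of
  norms.\<close>

lemma close_on_imp_hessian_accuracy:
  fixes q :: "real^'d^'d \<Rightarrow> real"
  assumes "is_norm q"
    and "close_on (trust_pairs p x0 r) (\<lambda>i. fst i powr N)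
      (\<lambda>i. hessian f (snd i)) (\<lambda>i. hessian (m (fst i)) (snd i))"
    and "\<And>\<Delta> x. (\<Delta>, x) \<in> trust_pairs p x0 r \<Longrightarrow>
      twice_differentiable_at f x \<and> twice_differentiable_at (m \<Delta>) x"
  shows "hessian_accuracy p q r N f m x0"
proof -
  obtain K where K: "K > 0" "\<And>v. q v \<le> K * norm v" using is_norm_le_norm[OF assms(1)] by metis
  obtain \<kappa> where \<kappa>: "\<kappa> \<ge> 0" "\<And>\<Delta> x. (\<Delta>, x) \<in> trust_pairs p x0 r \<Longrightarrow>
      norm (hessian f x - hessian (m \<Delta>) x) \<le> \<kappa> * \<Delta> powr N"
    using close_onE[OF assms(2)] by (metis fst_conv snd_conv)
  have "q (hessian f x - hessian (m \<Delta>) x) \<le> K * \<kappa> * \<Delta> powr N"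
    if "(\<Delta>, x) \<in> trust_pairs p x0 r" for \<Delta> x
    using order_trans[OF K(2) mult_left_mono[OF \<kappa>(2)[OF that]]] K(1) by (simp add: mult.assoc)
  then show ?thesis
    unfolding hessian_accuracy_def using K(1) \<kappa>(1) assms(3)
    by (intro exI[of _ "K * \<kappa>"]) (auto simp: trust_pairs_def)
qed

section \<open>Hessian accuracy of the quotient models\<close>

text \<open>A positive \<open>N2f\<close> keeps the model denominators away from zero only for small
  \<open>\<Delta>\<close>. For larger \<open>\<Delta>\<close>, pointwise nonvanishing gives no lower
  bound uniform in \<open>\<Delta>\<close>, since nothing relates models of different radii. Hence
  accuracy is stated up to some radius \<open>r\<close>, and up to \<open>R\<close> under such a
  uniform bound.\<close>

theorem theorem26:
  fixes f1 f2 :: "real^'d \<Rightarrow> real"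
    and m1 m2 :: "real \<Rightarrow> real^'d \<Rightarrow> real"
    and x0 :: "real^'d"
    and p :: "real^'d \<Rightarrow> real"
    and q :: "real^'d^'d \<Rightarrow> real"
    and R N1f N2f N1g N2g N1h N2h :: real
  assumes "is_norm p" and "is_norm q"
    and "C2 f1" and "C2 f2"
    and "R > 0"
    and "\<forall>\<Delta>\<in>{0<..R}. \<forall>x. twice_differentiable_at (m1 \<Delta>) x"
    and "\<forall>\<Delta>\<in>{0<..R}. \<forall>x. twice_differentiable_at (m2 \<Delta>) x"
    and "\<forall>\<Delta>\<in>{0<..R}. \<forall>x\<in>norm_cball p x0 \<Delta>. f2 x \<noteq> 0 \<and> m2 \<Delta> x \<noteq> 0"
    and "N1f \<ge> 0" and "N2f \<ge> 0" and "N1g \<ge> 0" and "N2g \<ge> 0" and "N1h \<ge> 0" and "N2h \<ge> 0"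
    and "function_accuracy p R N1f f1 m1 x0" and "function_accuracy p R N2f f2 m2 x0"
    and "gradient_accuracy p R N1g f1 m1 x0" and "gradient_accuracy p R N2g f2 m2 x0"
    and "hessian_accuracy p q R N1h f1 m1 x0" and "hessian_accuracy p q R N2h f2 m2 x0"
    and "N2f > 0"
  defines "F \<equiv> (\<lambda>x. f1 x / f2 x)"
    and "M \<equiv> (\<lambda>\<Delta> x. m1 \<Delta> x / m2 \<Delta> x)"
    and "N \<equiv> Min {N1f, N2f, N1g, N2g, N1h, N2h}"
  shows
    "(\<exists>r\<in>{0<..R}. hessian_accuracy p q r N F M x0) \<and>
     ((\<forall>\<epsilon>>0. \<exists>b>0. \<forall>\<Delta>\<in>{\<epsilon>..R}. \<forall>x\<in>norm_cball p x0 \<Delta>. b \<le> \<bar>m2 \<Delta> x\<bar>)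
       \<longrightarrow> hessian_accuracy p q R N F M x0)"
proof -
  note p = assms(1) and q = assms(2)
  let ?T = "trust_pairs p x0"
  have N: "N \<le> N1f" "N \<le> N2f" "N \<le> N1g" "N \<le> N2g" "N \<le> N1h" "N \<le> N2h" "0 \<le> N"
    using assms(9-14) by (auto simp: N_def)
  note c1 = close_on_function_accuracy[OF p \<open>C2 f1\<close> N(7,1) assms(15)]
    close_on_gradient_accuracy[OF p \<open>C2 f1\<close> N(7,3) assms(17)]
    close_on_hessian_accuracy[OF p q \<open>C2 f1\<close> N(7,5) assms(19)]
  note c2 = close_on_function_accuracy[OF p \<open>C2 f2\<close> N(7,2) assms(16)]
    close_on_gradient_accuracy[OF p \<open>C2 f2\<close> N(7,4) assms(18)]
    close_on_hessian_accuracy[OF p q \<open>C2 f2\<close> N(7,6) assms(20)]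

  have nz: "f2 x \<noteq> 0" "m2 \<Delta> x \<noteq> 0" and td: "twice_differentiable_at (m1 \<Delta>) x"
    "twice_differentiable_at (m2 \<Delta>) x" if "(\<Delta>, x) \<in> ?T R" for \<Delta> x
    using that assms(6,7,8) by (auto simp: trust_pairs_def)

  have "x0 \<in> norm_cball p x0 R"
    using is_norm_zero[OF p] \<open>R > 0\<close> by (simp add: norm_cball_def)
  moreover have "continuous_on (norm_cball p x0 R) (\<lambda>x. \<bar>f2 x\<bar>)"
    by (rule continuous_on_rabs[OF continuous_on_subset[OF C2D(2)[OF \<open>C2 f2\<close>] subset_UNIV]])
  ultimately obtain z where z: "z \<in> norm_cball p x0 R"
    "\<And>x. x \<in> norm_cball p x0 R \<Longrightarrow> \<bar>f2 z\<bar> \<le> \<bar>f2 x\<bar>"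
    using continuous_attains_inf[OF compact_norm_cball[OF p]] by (metis empty_iff)
  define c where "c = \<bar>f2 z\<bar>"
  \<comment> \<open>The ball containing \<open>z\<close> has radius \<open>R\<close>, so
    nonvanishing at \<open>z\<close> is the assumption for \<open>\<Delta> = R\<close>.\<close>
  have "c > 0" using assms(8) z(1) \<open>R > 0\<close> by (auto simp: c_def)
  have f2: "c \<le> \<bar>f2 x\<bar>" if "(\<Delta>, x) \<in> ?T R" for \<Delta> x
    using that z(2)[of x] by (auto simp: c_def trust_pairs_def norm_cball_def)

  \<comment> \<open>The core argument, for any radius up to which the model denominators have a
    uniform lower bound. It is applied to a small radius and to \<open>R\<close>.\<close>
  have main: "hessian_accuracy p q r N F M x0"
    if r: "r \<le> R" and b: "b > 0" "\<And>\<Delta> x. (\<Delta>, x) \<in> ?T r \<Longrightarrow> b \<le> \<bar>m2 \<Delta> x\<bar>" for r b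
  proof -
    have sub: "?T r \<subseteq> ?T R" using r by (auto simp: trust_pairs_def)
    note c1 = c1[THEN close_on_subset[OF _ sub]] and c2 = c2[THEN close_on_subset[OF _ sub]]
    define u where "u x = inverse (f2 x)" for x
    define v where "v \<Delta> x = inverse (m2 \<Delta> x)" for \<Delta> x
    \<comment> \<open>These equations hold on the whole space, also at zeros of the denominators,
      because division is multiplication by \<open>inverse\<close> even there.\<close>
    have F: "F = (\<lambda>x. f1 x * u x)" and M: "M = (\<lambda>\<Delta> x. m1 \<Delta> x * v \<Delta> x)"
      by (simp_all add: F_def M_def u_def v_def field_simps)
    have u: "twice_differentiable_at u x"
        "gradient u x = - (u x)\<^sup>2 *\<^sub>R gradient f2 x"
        "hessian u x = - (u x)\<^sup>2 *\<^sub>R hessian f2 x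
          + (2 * u x ^ 3) *\<^sub>R outer (gradient f2 x) (gradient f2 x)"
      and v: "twice_differentiable_at (v \<Delta>) x"
        "gradient (v \<Delta>) x = - (v \<Delta> x)\<^sup>2 *\<^sub>R gradient (m2 \<Delta>) x"
        "hessian (v \<Delta>) x = - (v \<Delta> x)\<^sup>2 *\<^sub>R hessian (m2 \<Delta>) x
          + (2 * v \<Delta> x ^ 3) *\<^sub>R outer (gradient (m2 \<Delta>) x) (gradient (m2 \<Delta>) x)"
      if "(\<Delta>, x) \<in> ?T r" for \<Delta> x
      using that sub twice_differentiable_at_inverse[OF C2D(1)[OF \<open>C2 f2\<close>] nz(1)]
        twice_differentiable_at_inverse[OF td(2) nz(2)]
      unfolding u_def v_def by (blast dest: subsetD)+
    have uv: "close_on (?T r) (\<lambda>i. fst i powr N) (\<lambda>i. u (snd i)) (\<lambda>i. v (fst i) (snd i))"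
      unfolding u_def v_def
    proof (rule close_on_inverse[OF c2(1)])
      \<comment> \<open>A common lower bound: \<open>c\<close> is for \<open>f2\<close>,
        \<open>b\<close> for the models.\<close>
      show "min b c > 0" using b(1) \<open>c > 0\<close> by simp
      show "min b c \<le> norm (f2 (snd i))" "min b c \<le> norm (m2 (fst i) (snd i))"
        if "i \<in> ?T r" for i
        using that sub b(2)[of "fst i" "snd i"] f2[of "fst i" "snd i"] by (auto simp: min_le_iff_disj)
    qed
    have guv: "close_on (?T r) (\<lambda>i. fst i powr N)
        (\<lambda>i. gradient u (snd i)) (\<lambda>i. gradient (v (fst i)) (snd i))"
    \<comment> \<open>On the index set no denominator vanishes, so the derivatives may be replaced
      by their explicit formulas, to which the propagation rules apply.\<close>
    proof (subst close_on_cong)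
      show "close_on (?T r) (\<lambda>i. fst i powr N)
          (\<lambda>i. - (u (snd i))\<^sup>2 *\<^sub>R gradient f2 (snd i))
          (\<lambda>i. - (v (fst i) (snd i))\<^sup>2 *\<^sub>R gradient (m2 (fst i)) (snd i))"
        by (intro close_on_scaleR close_on_minus close_on_power uv c2)
    qed (use u v in auto)
    have huv: "close_on (?T r) (\<lambda>i. fst i powr N)
        (\<lambda>i. hessian u (snd i)) (\<lambda>i. hessian (v (fst i)) (snd i))"
    proof (subst close_on_cong)
      show "close_on (?T r) (\<lambda>i. fst i powr N)
          (\<lambda>i. - (u (snd i))\<^sup>2 *\<^sub>R hessian f2 (snd i)
            + (2 * u (snd i) ^ 3) *\<^sub>R outer (gradient f2 (snd i)) (gradient f2 (snd i)))
          (\<lambda>i. - (v (fst i) (snd i))\<^sup>2 *\<^sub>R hessian (m2 (fst i)) (snd i)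
            + (2 * v (fst i) (snd i) ^ 3) *\<^sub>R
              outer (gradient (m2 (fst i)) (snd i)) (gradient (m2 (fst i)) (snd i)))"
        by (intro close_on_add close_on_scaleR close_on_mult close_on_outer close_on_const
            close_on_minus close_on_power uv c2)
    qed (use u v in auto)
    show ?thesis
    proof (rule close_on_imp_hessian_accuracy[OF q])
      show "close_on (?T r) (\<lambda>i. fst i powr N)
          (\<lambda>i. hessian F (snd i)) (\<lambda>i. hessian (M (fst i)) (snd i))"
      proof (subst close_on_cong)
        show "close_on (?T r) (\<lambda>i. fst i powr N)
            (\<lambda>i. f1 (snd i) *\<^sub>R hessian u (snd i) + u (snd i) *\<^sub>R hessian f1 (snd i)
              + (outer (gradient u (snd i)) (gradient f1 (snd i))
                + outer (gradient f1 (snd i)) (gradient u (snd i))))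
            (\<lambda>i. m1 (fst i) (snd i) *\<^sub>R hessian (v (fst i)) (snd i)
              + v (fst i) (snd i) *\<^sub>R hessian (m1 (fst i)) (snd i)
              + (outer (gradient (v (fst i)) (snd i)) (gradient (m1 (fst i)) (snd i))
                + outer (gradient (m1 (fst i)) (snd i)) (gradient (v (fst i)) (snd i))))"
          by (intro close_on_add close_on_scaleR close_on_outer c1 uv guv huv)
      next
        fix i assume i: "i \<in> ?T r"
        then have i': "(fst i, snd i) \<in> ?T r" "(fst i, snd i) \<in> ?T R" using sub by auto
        show "hessian F (snd i) = f1 (snd i) *\<^sub>R hessian u (snd i) + u (snd i) *\<^sub>R hessian f1 (snd i)
              + (outer (gradient u (snd i)) (gradient f1 (snd i))
                + outer (gradient f1 (snd i)) (gradient u (snd i)))"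
          unfolding F by (rule twice_differentiable_at_mult(2)[OF C2D(1)[OF \<open>C2 f1\<close>] u(1)[OF i'(1)]])
        show "hessian (M (fst i)) (snd i) = m1 (fst i) (snd i) *\<^sub>R hessian (v (fst i)) (snd i)
              + v (fst i) (snd i) *\<^sub>R hessian (m1 (fst i)) (snd i)
              + (outer (gradient (v (fst i)) (snd i)) (gradient (m1 (fst i)) (snd i))
                + outer (gradient (m1 (fst i)) (snd i)) (gradient (v (fst i)) (snd i)))"
          unfolding M by (rule twice_differentiable_at_mult(2)[OF td(1)[OF i'(2)] v(1)[OF i'(1)]])
      qed
      show "twice_differentiable_at F x \<and> twice_differentiable_at (M \<Delta>) x"
        if "(\<Delta>, x) \<in> ?T r" for \<Delta> x
        using that sub C2D(1)[OF \<open>C2 f1\<close>] unfolding F M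
        by (auto intro!: twice_differentiable_at_mult(1) u v td)
    qed
  qed

  obtain \<kappa> where \<kappa>: "\<kappa> \<ge> 0"
    "\<And>\<Delta> x. (\<Delta>, x) \<in> ?T R \<Longrightarrow> \<bar>f2 x - m2 \<Delta> x\<bar> \<le> \<kappa> * \<Delta> powr N2f"
    using assms(16) unfolding function_accuracy_def trust_pairs_def by auto
  \<comment> \<open>Chosen so that an error of at most \<open>\<kappa> * t\<close> uses up at most
    half of \<open>c\<close>. The summand 1 covers \<open>\<kappa> = 0\<close>.\<close>
  define t where "t = c / (2 * (\<kappa> + 1))"
  have t: "t > 0" "\<kappa> * t \<le> c / 2" using \<open>c > 0\<close> \<kappa>(1) by (auto simp: t_def field_simps)
  \<comment> \<open>For \<open>\<Delta>\<close> up to this radius \<open>\<Delta> powr N2f\<close>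
    is at most \<open>t\<close>; this is where positivity of \<open>N2f\<close> enters.\<close>
  define r where "r = min R (t powr (1 / N2f))"
  have r: "0 < r" "r \<le> R" using t(1) \<open>R > 0\<close> by (auto simp: r_def)
  have m2: "c / 2 \<le> \<bar>m2 \<Delta> x\<bar>" if T: "(\<Delta>, x) \<in> ?T R" and "\<Delta> \<le> r" for \<Delta> x
  proof -
    have "\<Delta> powr N2f \<le> (t powr (1 / N2f)) powr N2f"
      using that \<open>N2f > 0\<close> by (intro powr_mono2) (auto simp: trust_pairs_def r_def)
    also have "\<dots> = t" using \<open>N2f > 0\<close> t(1) by (simp add: powr_powr)
    finally have "\<kappa> * \<Delta> powr N2f \<le> c / 2"
      using t(2) \<kappa>(1) by (meson mult_left_mono order_trans)
    then show ?thesis using \<kappa>(2)[OF T] f2[OF T] by linarith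
  qed
  show ?thesis
  proof (intro conjI impI)
    have "hessian_accuracy p q r N F M x0"
      by (rule main[of r "c / 2"]) (use r \<open>c > 0\<close> m2 in \<open>auto simp: trust_pairs_def\<close>)
    then show "\<exists>r\<in>{0<..R}. hessian_accuracy p q r N F M x0" using r by auto
  next
    assume "\<forall>\<epsilon>>0. \<exists>b>0. \<forall>\<Delta>\<in>{\<epsilon>..R}. \<forall>x\<in>norm_cball p x0 \<Delta>. b \<le> \<bar>m2 \<Delta> x\<bar>"
    \<comment> \<open>The uniform bound is taken with \<open>\<epsilon> = r\<close>. Radii up to
      \<open>r\<close> are covered by \<open>m2\<close>, so the minimum of both bounds works on the
      whole range.\<close>
    then obtain b where b: "b > 0"
      "\<And>\<Delta> x. r \<le> \<Delta> \<Longrightarrow> \<Delta> \<le> R \<Longrightarrow> x \<in> norm_cball p x0 \<Delta> \<Longrightarrow> b \<le> \<bar>m2 \<Delta> x\<bar>"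
      using r(1) by (metis atLeastAtMost_iff)
    show "hessian_accuracy p q R N F M x0"
    proof (rule main[of R "min b (c / 2)"])
      fix \<Delta> x assume "(\<Delta>, x) \<in> ?T R"
      then show "min b (c / 2) \<le> \<bar>m2 \<Delta> x\<bar>"
        using m2[of \<Delta> x] b(2)[of \<Delta> x] by (cases "\<Delta> \<le> r") (auto simp: trust_pairs_def)
    qed (use b \<open>c > 0\<close> in auto)
  qed
qed

end
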